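(* Let $(G,p)$ be a (finite or infinite) bar-joint framework in $(\mathbb{R}^d,\|\cdot\|_{\mathcal{P}})$, where $\|\cdot\|_{\mathcal{P}}$ is a polyhedral norm. Then a mapping $u:V(G)\to\mathbb{R}^d$ is an infinitesimal flex of $(G,p)$ if and only if $$u_v-u_w\in\bigcap_{\varphi_F\in \mathrm{supp}_\Phi(vw)}\ker\varphi_F$$ for each edge $vw\in E(G)$.
   Context: Let $d\ge 2$ and let $\mathcal{P}\subset\mathbb{R}^d$ be a convex symmetric ($\mathcal P=-\mathcal P$) $d$-dimensional polytope. The associated polyhedral norm is $\|x\|_{\mathcal{P}}=\inf\{\lambda\ge 0: x\in\lambda\mathcal{P}\}$. The polar set is $\mathcal{P}^\triangle=\{y\in\mathbb{R}^d: x\cdot y\le 1\ \forall x\in\mathcal{P}\}$. For each facet $F$ of $\mathcal{P}$, $\hat F$ denotes the unique extreme point of $\mathcal{P}^\triangle$ with $F=\{x\in\mathcal{P}: x\cdot\hat F=1\}$, and $\varphi_F:\mathbb{R}^d\to\mathbb{R}$ is the linear functional $\varphi_F(x)=x\cdot\hat F$. A bar-joint framework $(G,p)$ consists of a simple undirected graph $G=(V(G),E(G))$ and a map $p:V(G)\to\mathbb{R}^d$, $v\mapsto p_v$, with $p_v\neq p_w$ whenever $vw\in E(G)$. An infinitesimal flex of $(G,p)$ is a map $u:V(G)\to\mathbb{R}^d$ such that for each edge $vw\in E(G)$, $\|(p_v+tu_v)-(p_w+tu_w)\|_{\mathcal{P}}-\|p_v-p_w\|_{\mathcal{P}}=o(t)$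 as $t\to 0$. A linear functional $f$ is a support functional for $x_0\in\mathbb{R}^d$ if $f(x_0)=\|x_0\|_{\mathcal P}^2$ and $\|f\|^*=\|x_0\|_{\mathcal P}$, where $\|f\|^*=\max_{x\in\mathcal{P}} f(x)$ is the dual norm. Fix an arbitrary orientation of each edge. For an oriented edge $vw$, $\mathrm{supp}_\Phi(vw)$ is the set of all linear functionals $\varphi_F$ ($F$ a facet of $\mathcal{P}$) which are support functionals for $\frac{p_v-p_w}{\|p_v-p_w\|_{\mathcal{P}}}$. *)

theory Defs
  imports "HOL-Analysis.Analysis" "HOL-Library.Landau_Symbols"
begin

definition polyhedral_norm :: "(real ^ 'd) set \<Rightarrow> real ^ 'd \<Rightarrow> real" where
  "polyhedral_norm P x = Inf {l. 0 \<le> l \<and> x \<in> (\<lambda>y. l *\<^sub>R y) ` P}"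

definition polar_set :: "(real ^ 'd) set \<Rightarrow> (real ^ 'd) set" where
  "polar_set P = {y. \<forall>x\<in>P. x \<bullet> y \<le> 1}"

definition facet_vector :: "(real ^ 'd) set \<Rightarrow> (real ^ 'd) set \<Rightarrow> real ^ 'd" where
  "facet_vector P F =
     (THE y. y extreme_point_of polar_set P \<and> F = {x \<in> P. x \<bullet> y = 1})"

definition facet_functional :: "(real ^ 'd) set \<Rightarrow> (real ^ 'd) set \<Rightarrow> real ^ 'd \<Rightarrow> real" where
  "facet_functional P F = (\<lambda>x. x \<bullet> facet_vector P F)"

text \<open>For a linear \<open>f\<close> and a (compact, nonempty) polytope \<open>P\<close> the supremum below is attained,
  so it is the maximum of \<open>f\<close> on \<open>P\<close>.\<close>

definition dual_norm :: "(real ^ 'd) set \<Rightarrow> (real ^ 'd \<Rightarrow> real) \<Rightarrow> real" where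
  "dual_norm P f = (SUP x\<in>P. f x)"

definition support_functional ::
    "(real ^ 'd) set \<Rightarrow> (real ^ 'd \<Rightarrow> real) \<Rightarrow> real ^ 'd \<Rightarrow> bool" where
  "support_functional P f x\<^sub>0 \<longleftrightarrow>
     linear f \<and> f x\<^sub>0 = (polyhedral_norm P x\<^sub>0)\<^sup>2 \<and> dual_norm P f = polyhedral_norm P x\<^sub>0"

text \<open>A simple undirected graph, finite or infinite; edges are two-element sets of vertices.\<close>

definition simple_graph :: "'v set \<Rightarrow> 'v set set \<Rightarrow> bool" where
  "simple_graph V E \<longleftrightarrow> (\<forall>e\<in>E. e \<subseteq> V \<and> card e = 2)"

text \<open>Maps on the vertex set are total functions on the vertex type; their values outside \<open>V\<close>
  are irrelevant.\<close>

definition bar_joint_framework ::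
    "'v set \<Rightarrow> 'v set set \<Rightarrow> ('v \<Rightarrow> real ^ 'd) \<Rightarrow> bool" where
  "bar_joint_framework V E p \<longleftrightarrow>
     simple_graph V E \<and> (\<forall>v w. {v, w} \<in> E \<longrightarrow> p v \<noteq> p w)"

definition infinitesimal_flex ::
    "(real ^ 'd) set \<Rightarrow> 'v set set \<Rightarrow> ('v \<Rightarrow> real ^ 'd) \<Rightarrow> ('v \<Rightarrow> real ^ 'd) \<Rightarrow> bool" where
  "infinitesimal_flex P E p u \<longleftrightarrow>
     (\<forall>v w. {v, w} \<in> E \<longrightarrow>
        (\<lambda>t::real. polyhedral_norm P ((p v + t *\<^sub>R u v) - (p w + t *\<^sub>R u w))
                     - polyhedral_norm P (p v - p w)) \<in> o[at 0](\<lambda>t. t))"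

text \<open>An orientation picks, for each edge \<open>e\<close>, the order \<open>(src e, tgt e)\<close> of its endpoints.\<close>

definition edge_orientation :: "'v set set \<Rightarrow> ('v set \<Rightarrow> 'v) \<Rightarrow> ('v set \<Rightarrow> 'v) \<Rightarrow> bool" where
  "edge_orientation E src tgt \<longleftrightarrow> (\<forall>e\<in>E. e = {src e, tgt e})"

definition supp_functionals ::
    "(real ^ 'd) set \<Rightarrow> ('v \<Rightarrow> real ^ 'd) \<Rightarrow> 'v \<Rightarrow> 'v \<Rightarrow> (real ^ 'd \<Rightarrow> real) set" where
  "supp_functionals P p v w =
     {facet_functional P F | F. F facet_of P \<and>
        support_functional P (facet_functional P F)
          ((p v - p w) /\<^sub>R polyhedral_norm P (p v - p w))}"

end

theory Submission imports Defs begin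

text \<open>
  The polar extreme points attached to the facets cut out \<open>P\<close>, so the polyhedral norm is the
  maximum of the finitely many facet functionals, and the support functionals of a nonzero
  \<open>x\<close>, after scaling, are those attaining this maximum. Moving \<open>x\<close> slightly in a direction
  annihilated by all of these leaves the norm unchanged; conversely each of them bounds the
  norm from below to first order, on both sides of \<open>t = 0\<close>, and so must vanish on the direction of
  a flex.
\<close>

section \<open>Points of the polar that expose a facet\<close>

lemma inner_eq_on_imp_eq:
  fixes y z :: "'a :: euclidean_space"
  assumes "aff_dim F \<ge> int DIM('a) - 1"
    and y: "\<And>x. x \<in> F \<Longrightarrow> x \<bullet> y = 1" and z: "\<And>x. x \<in> F \<Longrightarrow> x \<bullet> z = 1"
  shows "y = z"
proof -
  have "affine hull F \<subseteq> {x. y \<bullet> x = 1}"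
    using y by (intro hull_minimal affine_hyperplane) (auto simp: inner_commute)
  then have "0 \<notin> affine hull F" by auto
  \<comment> \<open>The origin lies off the affine hull of \<open>F\<close>, so adjoining it raises
    the affine dimension by one. Hence \<open>F\<close> spans the whole space, and
    \<open>y - z\<close>, being orthogonal to \<open>F\<close>, is orthogonal to itself.\<close>
  then have "aff_dim (insert 0 F) \<ge> DIM('a)"
    using assms(1) by (simp add: aff_dim_insert)
  then have "dim F \<ge> DIM('a)"
    using aff_dim_zero[of "insert 0 F"] dim_span[of "insert 0 F"] dim_span[of F]
    by (simp add: hull_inc span_insert_0 del: dim_span)
  then have "span F = UNIV"
    using dim_eq_full dim_subset_UNIV[of F] by (metis le_antisym)
  moreover have "orthogonal (y - z) x" if "x \<in> F" for x
    using y[OF that] z[OF that] by (simp add: orthogonal_def inner_diff_left inner_commute[of x])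
  ultimately have "orthogonal (y - z) (y - z)"
    using orthogonal_to_span[of "y - z" F] by (metis UNIV_I)
  then show ?thesis by (simp add: orthogonal_self)
qed

text \<open>If \<open>y\<close> lay strictly between polar points \<open>a\<close> and
  \<open>b\<close>, then on \<open>F\<close> the value 1 would be a proper convex combination of two
  values at most 1. Both values are then 1, and a set of codimension at most one leaves room for
  only one such vector.\<close>

lemma extreme_point_polar:
  fixes y :: "real ^ 'd"
  assumes F: "F \<subseteq> P" and dim: "aff_dim F \<ge> int CARD('d) - 1"
    and y: "y \<in> polar_set P" "\<And>x. x \<in> F \<Longrightarrow> x \<bullet> y = 1"
  shows "y extreme_point_of polar_set P"
  unfolding extreme_point_of_def
proof (intro conjI ballI notI y(1))
  fix a b assume ab: "a \<in> polar_set P" "b \<in> polar_set P" and "y \<in> open_segment a b"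
  then obtain t where t: "0 < t" "t < 1" "y = (1 - t) *\<^sub>R a + t *\<^sub>R b" and "a \<noteq> b"
    by (auto simp: in_segment)
  have eq1: "x \<bullet> a = 1 \<and> x \<bullet> b = 1" if "x \<in> F" for x
  proof -
    have le: "x \<bullet> a \<le> 1" "x \<bullet> b \<le> 1"
      using ab that F by (auto simp: polar_set_def)
    have "(1 - t) * (1 - x \<bullet> a) + t * (1 - x \<bullet> b) = 0"
      using y(2)[OF that] by (simp add: t(3) inner_add_right algebra_simps)
    moreover have "(1 - t) * (1 - x \<bullet> a) \<ge> 0" "t * (1 - x \<bullet> b) \<ge> 0"
      using t le by simp_all
    ultimately have "(1 - t) * (1 - x \<bullet> a) = 0" "t * (1 - x \<bullet> b) = 0"
      by linarith+
    with t show ?thesis by simp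
  qed
  have "a = b"
    by (rule inner_eq_on_imp_eq[of F]) (use dim eq1 in auto)
  with \<open>a \<noteq> b\<close> show False ..
qed

text \<open>This evaluates the definite description in \<open>facet_vector\<close>: a facet is large
  enough that a vector with value 1 on it is unique, and such a vector in the polar is automatically
  extreme.\<close>

lemma facet_vector_eqI:
  fixes P :: "(real ^ 'd) set"
  assumes "aff_dim P = int CARD('d)" and F: "F facet_of P"
    and y: "y \<in> polar_set P" "F = {x \<in> P. x \<bullet> y = 1}"
  shows "facet_vector P F = y"
  unfolding facet_vector_def
proof (rule the_equality)
  have dim: "aff_dim F \<ge> int CARD('d) - 1"
    using assms(1) F by (simp add: facet_of_def)
  show "y extreme_point_of polar_set P \<and> F = {x \<in> P. x \<bullet> y = 1}"
    using extreme_point_polar[OF facet_of_imp_subset[OF F] dim y(1)] y(2) by blast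
  show "z = y" if "z extreme_point_of polar_set P \<and> F = {x \<in> P. x \<bullet> z = 1}" for z
    by (rule inner_eq_on_imp_eq[of F]) (use dim that y(2) in auto)
qed

section \<open>Facets and defining inequalities of a symmetric polytope\<close>

locale symmetric_polytope =
  fixes P :: "(real ^ 'd) set"
  assumes polytope: "polytope P"
    and symmetric: "P = uminus ` P"
    and full_dim: "aff_dim P = int CARD('d)"
begin

lemma uminus_mem: "x \<in> P \<Longrightarrow> - x \<in> P"
  using symmetric by blast

text \<open>In a minimal halfspace description the facets are exactly the intersections of
  \<open>P\<close> with the bounding hyperplanes. Symmetry makes all right-hand sides positive, so
  they can be scaled to 1; the scaled normals then lie in the polar.\<close>

lemma facet_description:
  obtains H and y :: "(real ^ 'd) set \<Rightarrow> real ^ 'd"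
  where "P = {x. \<forall>h\<in>H. x \<bullet> y h \<le> 1}"
    and "\<And>F. F facet_of P \<longleftrightarrow> (\<exists>h\<in>H. F = {x \<in> P. x \<bullet> y h = 1})"
proof -
  have hull: "affine hull P = UNIV"
    using full_dim aff_dim_eq_full[of P] by simp
  obtain H where H: "finite H" "P = affine hull P \<inter> \<Inter>H"
      and "\<forall>h\<in>H. \<exists>a b. a \<noteq> 0 \<and> h = {x. a \<bullet> x \<le> b}"
      and min: "\<And>H'. H' \<subset> H \<Longrightarrow> P \<subset> affine hull P \<inter> \<Inter>H'"
    using polytope_imp_polyhedron[OF polytope] unfolding polyhedron_Int_affine_minimal by auto
  then obtain a b where ab: "\<And>h. h \<in> H \<Longrightarrow> a h \<noteq> 0 \<and> h = {x. a h \<bullet> x \<le> b h}"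
    by metis
  have mem: "x \<in> P \<longleftrightarrow> (\<forall>h\<in>H. a h \<bullet> x \<le> b h)" for x
  proof -
    have "x \<in> P \<longleftrightarrow> (\<forall>h\<in>H. x \<in> h)"
      using H(2) hull by blast
    then show ?thesis using ab by blast
  qed
  have "P \<noteq> {}" using full_dim by auto
  then obtain c where c: "c \<in> rel_interior P"
    using rel_interior_eq_empty polytope_imp_convex[OF polytope] by blast
  \<comment> \<open>The relative interior point \<open>c\<close> satisfies each inequality strictly
    and its reflection \<open>- c\<close> satisfies it weakly; adding the two gives
    \<open>0 < 2 * b h\<close>.\<close>
  have pos: "b h > 0" if "h \<in> H" for h
  proof -
    have "a h \<bullet> c < b h" and "c \<in> P"
      using c that rel_interior_polyhedron_explicit[OF H ab min] by auto
    moreover have "a h \<bullet> (- c) \<le> b h"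
      using \<open>c \<in> P\<close> that mem uminus_mem by blast
    ultimately show ?thesis by simp
  qed
  define y where "y h = a h /\<^sub>R b h" for h
  have le: "a h \<bullet> x \<le> b h \<longleftrightarrow> x \<bullet> y h \<le> 1" and eq: "a h \<bullet> x = b h \<longleftrightarrow> x \<bullet> y h = 1"
    if "h \<in> H" for h x
    using pos[OF that] by (auto simp: y_def field_simps inner_commute)
  show thesis
  proof
    show "P = {x. \<forall>h\<in>H. x \<bullet> y h \<le> 1}"
      using mem le by auto
    show "F facet_of P \<longleftrightarrow> (\<exists>h\<in>H. F = {x \<in> P. x \<bullet> y h = 1})" for F
      using facet_of_polyhedron_explicit[OF H ab min, of F] eq by (auto simp: Collect_conj_eq)
  qed
qed

text \<open>The normalized normal of the facet lies in the polar and exposes \<open>F\<close>, so it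
  coincides with \<open>facet_vector P F\<close>.\<close>

lemma facet_eq_functional:
  assumes "F facet_of P"
  shows "F = {x \<in> P. facet_functional P F x = 1}"
  and facet_functional_le_1: "x \<in> P \<Longrightarrow> facet_functional P F x \<le> 1"
proof -
  obtain H and y :: "(real ^ 'd) set \<Rightarrow> real ^ 'd"
    where P: "P = {x. \<forall>h\<in>H. x \<bullet> y h \<le> 1}"
      and "\<And>F. F facet_of P \<longleftrightarrow> (\<exists>h\<in>H. F = {x \<in> P. x \<bullet> y h = 1})"
    using facet_description by blast
  with assms obtain h where h: "h \<in> H" "F = {x \<in> P. x \<bullet> y h = 1}"
    by blast
  moreover have polar: "y h \<in> polar_set P"
    using P h(1) by (auto simp: polar_set_def)
  ultimately have "facet_vector P F = y h"
    using facet_vector_eqI full_dim assms by blast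
  with h(2) polar show "F = {x \<in> P. facet_functional P F x = 1}"
      and "x \<in> P \<Longrightarrow> facet_functional P F x \<le> 1"
    by (auto simp: facet_functional_def polar_set_def)
qed

text \<open>Every inequality of the minimal description comes from a facet, and its normal is the
  vector of that facet; so the facet functionals alone cut out \<open>P\<close>.\<close>

lemma mem_iff_facet_functional:
  "x \<in> P \<longleftrightarrow> (\<forall>F. F facet_of P \<longrightarrow> facet_functional P F x \<le> 1)"
proof (intro iffI allI impI)
  show "facet_functional P F x \<le> 1" if "x \<in> P" "F facet_of P" for F
    using facet_functional_le_1 that by blast
next
  assume x: "\<forall>F. F facet_of P \<longrightarrow> facet_functional P F x \<le> 1"
  obtain H and y :: "(real ^ 'd) set \<Rightarrow> real ^ 'd"
    where P: "P = {x. \<forall>h\<in>H. x \<bullet> y h \<le> 1}"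
      and facets: "\<And>F. F facet_of P \<longleftrightarrow> (\<exists>h\<in>H. F = {x \<in> P. x \<bullet> y h = 1})"
    using facet_description by blast
  have "x \<bullet> y h \<le> 1" if "h \<in> H" for h
  proof -
    define F where "F = {x \<in> P. x \<bullet> y h = 1}"
    have F: "F facet_of P" using facets F_def that by blast
    moreover have "y h \<in> polar_set P"
      using P that by (auto simp: polar_set_def)
    ultimately have "facet_vector P F = y h"
      using facet_vector_eqI full_dim F_def by blast
    then show ?thesis
      using x F by (auto simp: facet_functional_def)
  qed
  with P show "x \<in> P" by auto
qed

lemma linear_facet_functional: "linear (facet_functional P F)"
  unfolding facet_functional_def by (intro linearI) (simp_all add: inner_add_left)

lemma finite_facets: "finite {F. F facet_of P}"
  using finite_polytope_facets polytope by blast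

lemma zero_mem: "0 \<in> P"
  by (simp add: mem_iff_facet_functional facet_functional_def)

section \<open>The polyhedral norm as a maximum of facet functionals\<close>

lemma exists_facet_functional_pos:
  assumes "x \<noteq> 0"
  obtains F where "F facet_of P" "facet_functional P F x > 0"
proof (rule ccontr)
  assume "\<not> thesis"
  with that have nonpos: "facet_functional P F x \<le> 0" if "F facet_of P" for F
    using \<open>F facet_of P\<close> linorder_not_less by blast
  obtain B where B: "\<And>z. z \<in> P \<Longrightarrow> norm z \<le> B"
    using polytope_imp_bounded[OF polytope] by (auto simp: bounded_iff)
  \<comment> \<open>If no facet functional were positive at \<open>x\<close>, the whole ray through
    \<open>x\<close> would stay in \<open>P\<close>. This factor gives \<open>s *\<^sub>R x\<close>
    the length \<open>\<bar>B\<bar> + 1\<close>, which exceeds the bound \<open>B\<close>.\<close>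
  define s where "s = (\<bar>B\<bar> + 1) / norm x"
  have "s > 0" using assms by (auto simp: s_def intro!: divide_pos_pos)
  then have "facet_functional P F (s *\<^sub>R x) \<le> 1" if "F facet_of P" for F
    using mult_nonneg_nonpos[of s "facet_functional P F x"] nonpos[OF that]
    by (simp add: linear_scale[OF linear_facet_functional])
  then have "norm (s *\<^sub>R x) \<le> B"
    using B mem_iff_facet_functional by blast
  with assms show False by (simp add: s_def)
qed

lemma polyhedral_norm_0: "polyhedral_norm P 0 = 0"
proof -
  have "{l. 0 \<le> l \<and> (0 :: real ^ 'd) \<in> (\<lambda>y. l *\<^sub>R y) ` P} = {0..}"
    using zero_mem by force
  then show ?thesis by (simp add: polyhedral_norm_def)
qed

text \<open>For \<open>l > 0\<close>, membership of \<open>x\<close> in the dilate of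
  \<open>P\<close> by \<open>l\<close> says that no facet functional exceeds \<open>l\<close> at
  \<open>x\<close>. The admissible factors therefore form the closed ray starting at the maximum,
  whose infimum is its endpoint.\<close>

lemma polyhedral_norm_eq_Max:
  assumes "x \<noteq> 0"
  shows "polyhedral_norm P x = (MAX F\<in>{F. F facet_of P}. facet_functional P F x)"
proof -
  define M where "M = (MAX F\<in>{F. F facet_of P}. facet_functional P F x)"
  obtain F0 where F0: "F0 facet_of P" "facet_functional P F0 x > 0"
    using exists_facet_functional_pos assms by blast
  have M_le: "M \<le> l \<longleftrightarrow> (\<forall>F. F facet_of P \<longrightarrow> facet_functional P F x \<le> l)" for l
    unfolding M_def using F0(1) by (subst Max_le_iff) (auto simp: finite_facets)
  then have "facet_functional P F0 x \<le> M" using F0(1) by blast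
  with F0(2) have "M > 0" by linarith
  have "0 \<le> l \<and> x \<in> (\<lambda>y. l *\<^sub>R y) ` P \<longleftrightarrow> M \<le> l" for l
  proof (cases "l > 0")
    case True
    have "x \<in> (\<lambda>y. l *\<^sub>R y) ` P \<longleftrightarrow> x /\<^sub>R l \<in> P"
      using True by (force simp: image_iff)
    also have "\<dots> \<longleftrightarrow> M \<le> l"
      unfolding mem_iff_facet_functional M_le using True
      by (simp add: linear_scale[OF linear_facet_functional] field_simps)
    finally show ?thesis using True by simp
  next
    case False
    \<comment> \<open>Both sides fail here: the factor 0 produces only the zero vector, and
      \<open>M\<close> is positive.\<close>
    with \<open>M > 0\<close> assms show ?thesis by auto
  qed
  then have "{l. 0 \<le> l \<and> x \<in> (\<lambda>y. l *\<^sub>R y) ` P} = {M..}"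
    by auto
  then show ?thesis by (simp add: polyhedral_norm_def M_def)
qed

lemma facet_functional_le_polyhedral_norm:
  assumes "F facet_of P"
  shows "facet_functional P F x \<le> polyhedral_norm P x"
proof (cases "x = 0")
  case True
  then show ?thesis by (simp add: polyhedral_norm_0 facet_functional_def)
next
  case False
  then show ?thesis using assms by (auto simp: polyhedral_norm_eq_Max finite_facets intro!: Max_ge)
qed

lemma polyhedral_norm_attained:
  assumes "x \<noteq> 0"
  obtains F where "F facet_of P" "polyhedral_norm P x = facet_functional P F x"
proof -
  have "{F. F facet_of P} \<noteq> {}" using exists_facet_functional_pos assms by blast
  then have "polyhedral_norm P x \<in> (\<lambda>F. facet_functional P F x) ` {F. F facet_of P}"
    unfolding polyhedral_norm_eq_Max[OF assms] by (intro Max_in) (auto simp: finite_facets)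
  with that show thesis by blast
qed

lemma polyhedral_norm_pos: "x \<noteq> 0 \<Longrightarrow> polyhedral_norm P x > 0"
  using exists_facet_functional_pos facet_functional_le_polyhedral_norm
  by (metis order_less_le_trans)

lemma polyhedral_norm_minus: "polyhedral_norm P (- x) = polyhedral_norm P x"
proof -
  have "- x \<in> (\<lambda>y. l *\<^sub>R y) ` P \<longleftrightarrow> x \<in> (\<lambda>y. l *\<^sub>R y) ` P" for l
    using uminus_mem by (force simp: image_iff minus_equation_iff[of x])
  then show ?thesis by (simp add: polyhedral_norm_def)
qed

lemma polyhedral_norm_scaleR_pos:
  assumes "c > 0"
  shows "polyhedral_norm P (c *\<^sub>R x) = c * polyhedral_norm P x"
proof (cases "x = 0")
  case True
  then show ?thesis by (simp add: polyhedral_norm_0)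
next
  case False
  obtain F where F: "F facet_of P" "polyhedral_norm P x = facet_functional P F x"
    using polyhedral_norm_attained False by blast
  obtain G where G: "G facet_of P" "polyhedral_norm P (c *\<^sub>R x) = facet_functional P G (c *\<^sub>R x)"
    using polyhedral_norm_attained[of "c *\<^sub>R x"] False assms by auto
  \<comment> \<open>A facet attaining the norm at one of the two points bounds the norm at the other
    from below, which gives the two opposite inequalities.\<close>
  show ?thesis
    using facet_functional_le_polyhedral_norm[OF F(1), of "c *\<^sub>R x"]
      facet_functional_le_polyhedral_norm[OF G(1), of x] F(2) G(2) assms
    by (simp add: linear_scale[OF linear_facet_functional])
qed

section \<open>Facet functionals as support functionals\<close>

lemma dual_norm_facet_functional:
  assumes "F facet_of P"
  shows "dual_norm P (facet_functional P F) = 1"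
  unfolding dual_norm_def
proof (rule cSup_eq_maximum)
  have "F \<noteq> {}" using assms by (simp add: facet_of_def)
  then show "1 \<in> facet_functional P F ` P"
    using facet_eq_functional[OF assms]
    by (metis (mono_tags, lifting) all_not_in_conv image_eqI mem_Collect_eq)
  show "z \<le> 1" if "z \<in> facet_functional P F ` P" for z
    using that facet_functional_le_1[OF assms] by blast
qed

text \<open>Both the normalized vector and the facet functional have norm 1, so the only remaining
  condition is that the functional takes the value 1 at the normalized vector.\<close>

lemma support_functional_normalized_iff:
  assumes "F facet_of P" "x \<noteq> 0"
  shows "support_functional P (facet_functional P F) (x /\<^sub>R polyhedral_norm P x) \<longleftrightarrow>
    facet_functional P F x = polyhedral_norm P x"
  using polyhedral_norm_pos[OF assms(2)]
  by (auto simp: support_functional_def linear_facet_functional polyhedral_norm_scaleR_pos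
      dual_norm_facet_functional[OF assms(1)] linear_scale[OF linear_facet_functional] field_simps)

section \<open>First-order change of the norm along a line\<close>

lemma polyhedral_norm_smallo_iff:
  assumes "x \<noteq> 0"
  shows "(\<lambda>t. polyhedral_norm P (x + t *\<^sub>R z) - polyhedral_norm P x) \<in> o[at 0](\<lambda>t. t) \<longleftrightarrow>
    (\<forall>F. F facet_of P \<and> facet_functional P F x = polyhedral_norm P x \<longrightarrow> facet_functional P F z = 0)"
    (is "?D \<in> _ \<longleftrightarrow> ?R")
proof
  assume D: "?D \<in> o[at 0](\<lambda>t. t)"
  show ?R
  proof (intro allI impI, elim conjE)
    fix F assume F: "F facet_of P" and active: "facet_functional P F x = polyhedral_norm P x"
    \<comment> \<open>A facet functional lies below the norm everywhere, and an active one agrees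
      with it at \<open>x\<close>; the resulting linear lower bound holds for both signs of
      \<open>t\<close>.\<close>
    have bound: "t * facet_functional P F z \<le> ?D t" for t
      using facet_functional_le_polyhedral_norm[OF F, of "x + t *\<^sub>R z"] active
      by (simp add: linear_add[OF linear_facet_functional] linear_scale[OF linear_facet_functional])
    have "\<bar>facet_functional P F z\<bar> \<le> c" if "c > 0" for c
    proof -
      have "\<forall>\<^sub>F t in at 0. \<bar>?D t\<bar> \<le> c * \<bar>t\<bar>"
        using landau_o.smallD[OF D that] by simp
      then obtain d where d: "d > 0" "\<And>t. t \<noteq> 0 \<Longrightarrow> \<bar>t\<bar> < d \<Longrightarrow> \<bar>?D t\<bar> \<le> c * \<bar>t\<bar>"
        by (auto simp: eventually_at dist_real_def)
      have "t * facet_functional P F z \<le> c * \<bar>t\<bar>" if "t \<noteq> 0" "\<bar>t\<bar> < d" for t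
        using bound[of t] d(2)[OF that] by linarith
      \<comment> \<open>The positive test point bounds the value at \<open>z\<close> above by
        \<open>c\<close>, the negative one bounds it below by \<open>- c\<close>.\<close>
      from this[of "d / 2"] this[of "- d / 2"] d(1)
      have "d * facet_functional P F z \<le> d * c" "d * (- facet_functional P F z) \<le> d * c"
        by (simp_all add: mult.commute)
      with d(1) show ?thesis
        by (simp only: mult_le_cancel_left_pos abs_le_iff)
    qed
    from this[of "\<bar>facet_functional P F z\<bar> / 2"] show "facet_functional P F z = 0"
      by (cases "facet_functional P F z = 0") simp_all
  qed
next
  assume R: ?R
  \<comment> \<open>Active functionals are constant along the line by \<open>?R\<close>; inactive
    ones start strictly below the norm and stay there for small \<open>t\<close> by
    continuity.\<close>
  have "\<forall>\<^sub>F t in at 0. facet_functional P F (x + t *\<^sub>R z) \<le> polyhedral_norm P x"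
    if F: "F facet_of P" for F
  proof (cases "facet_functional P F x = polyhedral_norm P x")
    case True
    then show ?thesis
      using R F by (simp add: linear_add[OF linear_facet_functional] linear_scale[OF linear_facet_functional])
  next
    case False
    then have less: "facet_functional P F x < polyhedral_norm P x"
      using facet_functional_le_polyhedral_norm[OF F] by (simp add: less_le)
    have "((\<lambda>t. facet_functional P F (x + t *\<^sub>R z)) \<longlongrightarrow> facet_functional P F (x + 0 *\<^sub>R z)) (at 0)"
      unfolding facet_functional_def by (intro tendsto_intros)
    then have "\<forall>\<^sub>F t in at 0. facet_functional P F (x + t *\<^sub>R z) < polyhedral_norm P x"
      using less by (intro order_tendstoD(2)) auto
    then show ?thesis by eventually_elim simp
  qed
  \<comment> \<open>Finiteness of the set of facets yields one neighbourhood of 0 that serves all of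
    them.\<close>
  then have le: "\<forall>\<^sub>F t in at 0. \<forall>F\<in>{F. F facet_of P}.
      facet_functional P F (x + t *\<^sub>R z) \<le> polyhedral_norm P x"
    by (intro eventually_ball_finite finite_facets) auto
  have "((\<lambda>t. x + t *\<^sub>R z) \<longlongrightarrow> x + 0 *\<^sub>R z) (at (0::real))"
    by (intro tendsto_intros)
  then have nz: "\<forall>\<^sub>F t in at (0::real). x + t *\<^sub>R z \<noteq> 0"
    using assms by (intro tendsto_imp_eventually_ne) auto
  obtain F0 where F0: "F0 facet_of P" "polyhedral_norm P x = facet_functional P F0 x"
    using polyhedral_norm_attained assms by blast
  \<comment> \<open>The norm is in fact constant near \<open>t = 0\<close>: the active functional of
    \<open>F0\<close> keeps it from dropping, and \<open>le\<close> keeps it from growing.\<close>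
  from le nz have "\<forall>\<^sub>F t in at 0. ?D t = 0"
  proof eventually_elim
    case (elim t)
    obtain F where F: "F facet_of P"
        "polyhedral_norm P (x + t *\<^sub>R z) = facet_functional P F (x + t *\<^sub>R z)"
      using polyhedral_norm_attained elim(2) by blast
    have "facet_functional P F0 (x + t *\<^sub>R z) = polyhedral_norm P x"
      using R F0 by (simp add: linear_add[OF linear_facet_functional] linear_scale[OF linear_facet_functional])
    then have "polyhedral_norm P x \<le> polyhedral_norm P (x + t *\<^sub>R z)"
      using facet_functional_le_polyhedral_norm[OF F0(1), of "x + t *\<^sub>R z"] by simp
    moreover have "polyhedral_norm P (x + t *\<^sub>R z) \<le> polyhedral_norm P x"
      using elim(1) F by simp
    ultimately show ?case by simp
  qed
  then show "?D \<in> o[at 0](\<lambda>t. t)"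
    using landau_o.small.in_cong[of ?D "\<lambda>_. 0" "at 0"] by simp
qed

section \<open>The flex condition on a single edge\<close>

lemma edge_smallo_iff:
  fixes p u :: "'v \<Rightarrow> real ^ 'd"
  assumes "p v \<noteq> p w"
  shows "(\<lambda>t. polyhedral_norm P ((p v + t *\<^sub>R u v) - (p w + t *\<^sub>R u w))
        - polyhedral_norm P (p v - p w)) \<in> o[at 0](\<lambda>t. t) \<longleftrightarrow>
    u v - u w \<in> (\<Inter>\<phi>\<in>supp_functionals P p v w. {x. \<phi> x = 0})"
proof -
  have diff: "(p v + t *\<^sub>R u v) - (p w + t *\<^sub>R u w) = (p v - p w) + t *\<^sub>R (u v - u w)" for t
    by (simp add: algebra_simps)
  have "p v - p w \<noteq> 0" using assms by simp
  then have supp: "supp_functionals P p v w = {facet_functional P F | F.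
      F facet_of P \<and> facet_functional P F (p v - p w) = polyhedral_norm P (p v - p w)}"
    using support_functional_normalized_iff unfolding supp_functionals_def by blast
  show ?thesis
    unfolding diff supp polyhedral_norm_smallo_iff[OF \<open>p v - p w \<noteq> 0\<close>] by blast
qed

text \<open>Needed because \<open>infinitesimal_flex\<close> quantifies over both orders of the
  endpoints, whereas an orientation selects one. Swapping them negates both arguments of the
  norm.\<close>

lemma edge_smallo_commute:
  fixes p u :: "'v \<Rightarrow> real ^ 'd"
  shows "(\<lambda>t. polyhedral_norm P ((p v + t *\<^sub>R u v) - (p w + t *\<^sub>R u w))
        - polyhedral_norm P (p v - p w)) =
    (\<lambda>t. polyhedral_norm P ((p w + t *\<^sub>R u w) - (p v + t *\<^sub>R u v))
        - polyhedral_norm P (p w - p v))"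
  using polyhedral_norm_minus[of "p v - p w"]
    polyhedral_norm_minus[of "(p v + t *\<^sub>R u v) - (p w + t *\<^sub>R u w)" for t]
  by simp

end

theorem theorem2p5:
  fixes P :: "(real ^ 'd) set"
    and V :: "'v set" and E :: "'v set set"
    and p u :: "'v \<Rightarrow> real ^ 'd"
    and src tgt :: "'v set \<Rightarrow> 'v"
  assumes "CARD('d) \<ge> 2"
    and "polytope P"
    and "P = uminus ` P"
    and "aff_dim P = int CARD('d)"
    and "bar_joint_framework V E p"
    and "edge_orientation E src tgt"
  shows "infinitesimal_flex P E p u \<longleftrightarrow>
    (\<forall>e\<in>E. u (src e) - u (tgt e) \<in>
       (\<Inter>\<phi>\<in>supp_functionals P p (src e) (tgt e). {x. \<phi> x = 0}))"
proof -
  interpret symmetric_polytope P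
    using assms(2-4) by (rule symmetric_polytope.intro)
  let ?L = "\<lambda>v w. (\<lambda>t::real. polyhedral_norm P ((p v + t *\<^sub>R u v) - (p w + t *\<^sub>R u w))
      - polyhedral_norm P (p v - p w)) \<in> o[at 0](\<lambda>t. t)"
  have ends: "e = {src e, tgt e}" if "e \<in> E" for e
    using assms(6) that unfolding edge_orientation_def by blast
  then have ends_mem: "{src e, tgt e} \<in> E" if "e \<in> E" for e
    using that by metis
  have "infinitesimal_flex P E p u \<longleftrightarrow> (\<forall>e\<in>E. ?L (src e) (tgt e))"
  proof
    assume "infinitesimal_flex P E p u"
    then show "\<forall>e\<in>E. ?L (src e) (tgt e)"
      unfolding infinitesimal_flex_def using ends_mem by blast
  next
    assume R: "\<forall>e\<in>E. ?L (src e) (tgt e)"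
    have "?L v w" if vw: "{v, w} \<in> E" for v w
    proof -
      have L: "?L (src {v, w}) (tgt {v, w})" using R vw by blast
      \<comment> \<open>The orientation of the edge either agrees with the order \<open>v\<close>,
        \<open>w\<close> or reverses it; the symmetry of the norm settles the reversed case.\<close>
      consider "src {v, w} = v" "tgt {v, w} = w" | "src {v, w} = w" "tgt {v, w} = v"
        using ends[OF vw] by (auto simp: doubleton_eq_iff)
      then show ?thesis
      proof cases
        case 1
        with L show ?thesis by simp
      next
        case 2
        with L show ?thesis by (subst edge_smallo_commute) simp
      qed
    qed
    then show "infinitesimal_flex P E p u"
      by (simp add: infinitesimal_flex_def)
  qed
  \<comment> \<open>Distinct endpoint positions make the edge vector nonzero, as the
    characterization on a single edge requires.\<close>
  moreover have "p (src e) \<noteq> p (tgt e)" if "e \<in> E" for e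
    using assms(5) ends_mem[OF that] unfolding bar_joint_framework_def by blast
  ultimately show ?thesis
    by (simp add: edge_smallo_iff)
qed

end
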